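(* Assume the following conditions. (1) For sufficiently large $n$, $m\leqslant|\mathcal{A}_{0n}|$, and as $n\to\infty$, $m/n\to\tau\in[1/2,1-\epsilon]$. (2) For all $\alpha\in(0,\epsilon/(1-\tau)]$, $\inf_{\theta\in\Theta}d_{\mathrm K}\big((1-\alpha)F_{\theta_0}+\alpha G,F_\theta\big)>0$. Then the objective functions $$\psi_n(\mathcal{A})=\inf_{\theta\in\Theta}d_{\mathrm K}(\hat{H}_{\mathcal{A}},F_\theta),\quad\mathcal{A}\in\mathfrak{D}_n,$$ (weakly) separate $\mathfrak{A}$ from $\mathfrak{B}$; that is, for all $\{\mathcal{A}_n\}\in\mathfrak{A}$ and $\{\mathcal{B}_n\}\in\mathfrak{B}$, $\limsup_{n\to\infty}[\psi_n(\mathcal{A}_n)-\psi_n(\mathcal{B}_n)]<0$ almost surely.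
   Context: Contaminated model. $\mathbb{Z}_n=\{1,\ldots,n\}$. $\mathcal{F}^p$ is the set of all cumulative distribution functions on $\mathbb{R}^p$; $F_\theta\in\mathcal{F}^p$ for $\theta\in\Theta\subset\mathbb{R}^q$, and $G\in\mathcal{F}^p$ is the contamination distribution. $\theta_0\in\Theta$ is the true parameter and $\epsilon\in[0,1/2]$. $\mathfrak{S}=\{\{k_n\}:k_n\in\mathbb{N},\ k_1<k_2<\cdots\}$ is the set of all subsequences of $\{n\}_{n=1,2,\ldots}$. Let $\{l_n\}$ be a nondecreasing integer sequence with $l_n/n\to1-\epsilon$, let $\{k_n^0\}\in\mathfrak{S}$, and let $\mathcal{A}_{0n}=\{k_1^0,\ldots,k_{l_n}^0\}\subset\mathbb{Z}_n$ be the index set of all good observations. The observations are a sequence of random variables such that $X_1,\ldots,X_n$ are independent with $X_i\sim F_{\theta_0}$ for $i\in\mathcal{A}_{0n}$ and $X_i\sim G$ for $i\in\mathbb{Z}_n\setminus\mathcal{A}_{0n}$. Decision spaces. $m=m_n<n$ is a pre-specified integer, $|\cdot|$ denotes cardinality, $I$ is the indicator function, and $\mathfrak{D}_n=\{\mathcal{A}\subset\mathbb{Z}_n:|\mathcal{A}|=m\}$. Let $\mathfrak{S}_0=\{\{k_n\}\in\mathfrak{S}:\{k_1,\ldots,k_m\}\subset\mathcal{A}_{0n}\text{ for all }n\}$ and $\mathfrak{S}_1=\{\{k_n\}\in\mathfrak{S}:\sum_{i=1}^mI(k_i\notin\mathcal{A}_{0n})/m\to\alpha\text{ for some }\alpha>0\text{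 as }n\to\infty\}$. $\mathfrak{A}$ (resp. $\mathfrak{B}$) is the set of sequences $\{\mathcal{A}_n\}\in\prod_{n=1}^\infty\mathfrak{D}_n$ for which there is $\{k_n\}\in\mathfrak{S}_0$ (resp. $\{k_n\}\in\mathfrak{S}_1$) with $\mathcal{A}_n=\{k_1,\ldots,k_m\}$ for all $n$. $d_{\mathrm K}(F,H)=\sup_{x\in\mathbb{R}^p}|F(x)-H(x)|$ is the Kolmogorov distance, and $\hat{H}_{\mathcal{A}}$ is the empirical distribution function based on the observations $\{X_i\}_{i\in\mathcal{A}}$. *)

theory Defs
  imports "HOL-Probability.Probability"
begin

text \<open>Throughout, the sequences of the model are indexed by \<open>1, 2, \<dots>\<close>; values at index \<open>0\<close> are
  unconstrained and never used. The order on \<^typ>\<open>real ^ 'p\<close> is componentwise, so \<open>{..x}\<close> is the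
  lower-left orthant at \<open>x\<close>.\<close>

definition mcdf :: "(real ^ 'p) measure \<Rightarrow> real ^ 'p \<Rightarrow> real" where
  "mcdf N x = measure N {..x}"

definition distribution_functions :: "(real ^ 'p \<Rightarrow> real) set" where
  "distribution_functions = {mcdf N | N. prob_space N \<and> sets N = sets borel}"

definition kolmogorov_dist :: "(real ^ 'p \<Rightarrow> real) \<Rightarrow> (real ^ 'p \<Rightarrow> real) \<Rightarrow> real" where
  "kolmogorov_dist F H = (SUP x. \<bar>F x - H x\<bar>)"

definition empirical_cdf ::
    "(nat \<Rightarrow> 'w \<Rightarrow> real ^ 'p) \<Rightarrow> nat set \<Rightarrow> 'w \<Rightarrow> real ^ 'p \<Rightarrow> real" where
  "empirical_cdf X A w x = (\<Sum>i\<in>A. of_bool (X i w \<le> x)) / real (card A)"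

definition index_seqs :: "(nat \<Rightarrow> nat) set" where
  "index_seqs = {k. strict_mono_on {1..} k \<and> k 1 \<ge> 1}"

text \<open>The set \<open>{k\<^sub>1, \<dots>, k\<^sub>j}\<close>, where \<open>j\<close> is the \<open>n\<close>-th term of the given size sequence.\<close>

definition initial_indices :: "(nat \<Rightarrow> nat) \<Rightarrow> (nat \<Rightarrow> nat) \<Rightarrow> nat \<Rightarrow> nat set" where
  "initial_indices k s n = k ` {1..s n}"

definition decision_space :: "(nat \<Rightarrow> nat) \<Rightarrow> nat \<Rightarrow> nat set set" where
  "decision_space m n = {A. A \<subseteq> {1..n} \<and> card A = m n}"

text \<open>Below, \<open>A0 n\<close> is the index set of the good observations among the first \<open>n\<close>.\<close>

definition good_seqs :: "(nat \<Rightarrow> nat) \<Rightarrow> (nat \<Rightarrow> nat set) \<Rightarrow> (nat \<Rightarrow> nat) set" where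
  "good_seqs m A0 = {k \<in> index_seqs. \<forall>n\<ge>1. initial_indices k m n \<subseteq> A0 n}"

definition bad_seqs :: "(nat \<Rightarrow> nat) \<Rightarrow> (nat \<Rightarrow> nat set) \<Rightarrow> (nat \<Rightarrow> nat) set" where
  "bad_seqs m A0 = {k \<in> index_seqs. \<exists>\<alpha>>0.
     (\<lambda>n. (\<Sum>i=1..m n. of_bool (k i \<notin> A0 n)) / real (m n)) \<longlonglongrightarrow> \<alpha>}"

definition decisions_along :: "(nat \<Rightarrow> nat) \<Rightarrow> (nat \<Rightarrow> nat) set \<Rightarrow> (nat \<Rightarrow> nat set) set" where
  "decisions_along m S = {A \<in> Pi {1..} (decision_space m).
     \<exists>k\<in>S. \<forall>n\<ge>1. A n = initial_indices k m n}"

definition good_decisions :: "(nat \<Rightarrow> nat) \<Rightarrow> (nat \<Rightarrow> nat set) \<Rightarrow> (nat \<Rightarrow> nat set) set" where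
  "good_decisions m A0 = decisions_along m (good_seqs m A0)"

definition bad_decisions :: "(nat \<Rightarrow> nat) \<Rightarrow> (nat \<Rightarrow> nat set) \<Rightarrow> (nat \<Rightarrow> nat set) set" where
  "bad_decisions m A0 = decisions_along m (bad_seqs m A0)"

definition weakly_separates ::
    "'w measure \<Rightarrow> (nat \<Rightarrow> nat set \<Rightarrow> 'w \<Rightarrow> real) \<Rightarrow>
      (nat \<Rightarrow> nat set) set \<Rightarrow> (nat \<Rightarrow> nat set) set \<Rightarrow> bool" where
  "weakly_separates M \<psi> \<AA> \<BB> \<longleftrightarrow>
     (\<forall>A\<in>\<AA>. \<forall>B\<in>\<BB>. AE w in M. limsup (\<lambda>n. ereal (\<psi> n (A n) w - \<psi> n (B n) w)) < 0)"

end

theory Submission imports Defs begin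

text \<open>Along a fixed index sequence \<open>k\<close> the first \<open>m n\<close> observations are independent, and each has
  one of the two laws \<open>F \<theta>0\<close> and \<open>G\<close>. If the fraction of contaminated indices among them tends to
  \<open>\<alpha>\<close>, then their averaged law tends uniformly to the mixture \<open>(1 - \<alpha>) F \<theta>0 + \<alpha> G\<close>. A
  Glivenko--Cantelli theorem for independent observations with finitely many different laws
  (\<open>glivenko_cantelli\<close>) shows that almost surely the empirical distribution function is uniformly
  close to the averaged one, hence converges in Kolmogorov distance to the mixture
  (\<open>empirical_cdf_tendsto_mixture\<close>).

  For a good decision sequence \<open>\<alpha> = 0\<close>, so the objective function, being bounded by the distance
  to \<open>F \<theta>0\<close> itself, tends to zero. For a bad one, the map sending \<open>H\<close> to the infimum over
  \<open>\<theta> \<in> \<Theta>\<close> of the distance from \<open>H\<close> to \<open>F \<theta>\<close> is 1-Lipschitz, so the objective function stays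
  eventually above any number less than the infimum \<open>c\<close> for the mixture. This \<open>c\<close> is positive
  because the contamination rate is admissible: at most about \<open>\<epsilon> n\<close> of the first \<open>n\<close> indices are
  contaminated and about \<open>\<tau> n\<close> are chosen, so \<open>\<alpha> \<tau> \<le> \<epsilon>\<close> (\<open>bad_fraction_le\<close>), and
  \<open>\<tau> \<ge> 1 - \<tau>\<close> since \<open>\<tau> \<ge> 1/2\<close>.

  The Glivenko--Cantelli theorem is obtained by bracketing. Finitely many pairs \<open>L \<subseteq> U\<close> of
  Borel sets enclose every orthant with a gap \<open>U - L\<close> that is small under all the laws involved.
  For each single set \<open>L\<close> or \<open>U\<close>, Hoeffding's inequality and the Borel--Cantelli lemma give the
  strong law, and monotonicity carries it over to all orthants at once.\<close>

section \<open>Finite bracketings\<close>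

text \<open>A bracket is required to be narrow under every law in \<open>N\<close> simultaneously; this is what makes
  the uniform law below work for observations that are not identically distributed.\<close>

definition finitely_bracketed :: "'a::topological_space measure set \<Rightarrow> real \<Rightarrow> 'a set set \<Rightarrow> bool" where
  "finitely_bracketed N \<delta> \<C> \<longleftrightarrow>
     (\<exists>B. finite B \<and> B \<subseteq> sets borel \<times> sets borel \<and>
        (\<forall>S\<in>\<C>. \<exists>p\<in>B. fst p \<subseteq> S \<and> S \<subseteq> snd p \<and> (\<forall>\<mu>\<in>N. measure \<mu> (snd p - fst p) \<le> \<delta>)))"

lemma finitely_bracketed_single:
  assumes "L \<in> sets borel" "U \<in> sets borel" "\<And>\<mu>. \<mu> \<in> N \<Longrightarrow> measure \<mu> (U - L) \<le> \<delta>"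
    and "\<And>S. S \<in> \<C> \<Longrightarrow> L \<subseteq> S \<and> S \<subseteq> U"
  shows "finitely_bracketed N \<delta> \<C>"
  unfolding finitely_bracketed_def using assms by (intro exI[of _ "{(L, U)}"]) auto

lemma finitely_bracketed_Un:
  assumes "finitely_bracketed N \<delta> \<C>" "finitely_bracketed N \<delta> \<D>"
  shows "finitely_bracketed N \<delta> (\<C> \<union> \<D>)"
proof -
  obtain B where B: "finite B" "B \<subseteq> sets borel \<times> sets borel"
    "\<forall>S\<in>\<C>. \<exists>p\<in>B. fst p \<subseteq> S \<and> S \<subseteq> snd p \<and> (\<forall>\<mu>\<in>N. measure \<mu> (snd p - fst p) \<le> \<delta>)"
    using assms(1) unfolding finitely_bracketed_def by (elim exE conjE)
  obtain D where D: "finite D" "D \<subseteq> sets borel \<times> sets borel"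
    "\<forall>S\<in>\<D>. \<exists>p\<in>D. fst p \<subseteq> S \<and> S \<subseteq> snd p \<and> (\<forall>\<mu>\<in>N. measure \<mu> (snd p - fst p) \<le> \<delta>)"
    using assms(2) unfolding finitely_bracketed_def by (elim exE conjE)
  show ?thesis
    unfolding finitely_bracketed_def
  proof (intro exI[of _ "B \<union> D"] conjI ballI)
    fix S assume "S \<in> \<C> \<union> \<D>"
    then show "\<exists>p\<in>B \<union> D. fst p \<subseteq> S \<and> S \<subseteq> snd p \<and> (\<forall>\<mu>\<in>N. measure \<mu> (snd p - fst p) \<le> \<delta>)"
      unfolding bex_Un by (rule UnE) (erule disjI1[OF bspec[OF B(3)]], erule disjI2[OF bspec[OF D(3)]])
  qed (use B D in auto)
qed

lemma finitely_bracketed_subset: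
  assumes "finitely_bracketed N \<delta> \<D>" "\<C> \<subseteq> \<D>"
  shows "finitely_bracketed N \<delta> \<C>"
  using assms(1) unfolding finitely_bracketed_def
  by (elim exE conjE, intro exI conjI) (use assms(2) in auto)

text \<open>Intersecting brackets componentwise encloses the intersection, and the gap of the
  intersected bracket is covered by the union of the individual gaps. Choosing one bracket for each
  \<open>c\<close> leaves finitely many combinations because the index type is finite.\<close>

lemma finitely_bracketed_INT:
  fixes \<C> :: "'c::finite \<Rightarrow> 'a::topological_space set set"
  assumes br: "\<And>c. finitely_bracketed N \<delta> (\<C> c)"
    and N: "\<And>\<mu>. \<mu> \<in> N \<Longrightarrow> prob_space \<mu> \<and> sets \<mu> = sets borel"
  shows "finitely_bracketed N (real CARD('c) * \<delta>) {\<Inter>c. S c | S. \<forall>c. S c \<in> \<C> c}"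
proof -
  have "\<forall>c. \<exists>B. finite B \<and> B \<subseteq> sets borel \<times> sets borel \<and>
        (\<forall>S\<in>\<C> c. \<exists>p\<in>B. fst p \<subseteq> S \<and> S \<subseteq> snd p \<and> (\<forall>\<mu>\<in>N. measure \<mu> (snd p - fst p) \<le> \<delta>))"
    using br unfolding finitely_bracketed_def by blast
  then obtain B where fin: "\<And>c. finite (B c)"
    and meas: "\<And>c. B c \<subseteq> sets borel \<times> sets borel"
    and cov: "\<And>c S. S \<in> \<C> c \<Longrightarrow>
      \<exists>p\<in>B c. fst p \<subseteq> S \<and> S \<subseteq> snd p \<and> (\<forall>\<mu>\<in>N. measure \<mu> (snd p - fst p) \<le> \<delta>)"
    by metis
  define D where "D = (\<lambda>g. (\<Inter>c. fst (g c), \<Inter>c. snd (g c))) ` (Pi\<^sub>E UNIV B)"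
  show ?thesis
    unfolding finitely_bracketed_def
  proof (intro exI[of _ D] conjI ballI)
    show "finite D" unfolding D_def using fin by (intro finite_imageI finite_PiE) auto
    have "(\<Inter>c. fst (g c)) \<in> sets borel \<and> (\<Inter>c. snd (g c)) \<in> sets borel" if "g \<in> Pi\<^sub>E UNIV B" for g
    proof -
      have "g c \<in> sets borel \<times> sets borel" for c
        using that meas[of c] by (auto simp: PiE_iff)
      then have "fst (g c) \<in> sets borel" "snd (g c) \<in> sets borel" for c
        by (simp_all add: mem_Times_iff)
      then show ?thesis by (intro conjI sets.countable_INT) auto
    qed
    then show "D \<subseteq> sets borel \<times> sets borel" unfolding D_def by auto
  next
    fix T assume "T \<in> {\<Inter>c. S c | S. \<forall>c. S c \<in> \<C> c}"
    then obtain S where T: "T = (\<Inter>c. S c)" and S: "\<And>c. S c \<in> \<C> c" by blast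
    have "\<exists>p. p \<in> B c \<and> fst p \<subseteq> S c \<and> S c \<subseteq> snd p \<and> (\<forall>\<mu>\<in>N. measure \<mu> (snd p - fst p) \<le> \<delta>)" for c
      using cov[OF S[of c]] by blast
    then obtain g where g: "\<And>c. g c \<in> B c" "\<And>c. fst (g c) \<subseteq> S c" "\<And>c. S c \<subseteq> snd (g c)"
      "\<And>c \<mu>. \<mu> \<in> N \<Longrightarrow> measure \<mu> (snd (g c) - fst (g c)) \<le> \<delta>"
      by metis
    have gm: "fst (g c) \<in> sets borel" "snd (g c) \<in> sets borel" for c
      using g(1)[of c] meas[of c] by (auto simp: mem_Times_iff)
    have "measure \<mu> ((\<Inter>c. snd (g c)) - (\<Inter>c. fst (g c))) \<le> real CARD('c) * \<delta>" if "\<mu> \<in> N" for \<mu>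
    proof -
      interpret \<mu>: prob_space \<mu> using N that by blast
      have s: "sets \<mu> = sets borel" using N that by blast
      have "measure \<mu> ((\<Inter>c. snd (g c)) - (\<Inter>c. fst (g c))) \<le> measure \<mu> (\<Union>c. snd (g c) - fst (g c))"
        by (intro \<mu>.finite_measure_mono) (use gm s in auto)
      also have "\<dots> \<le> (\<Sum>c\<in>UNIV. measure \<mu> (snd (g c) - fst (g c)))"
        by (intro measure_UNION_le) (use gm s in auto)
      also have "\<dots> \<le> (\<Sum>c\<in>(UNIV::'c set). \<delta>)"
        by (intro sum_mono g(4) that)
      finally show ?thesis by simp
    qed
    moreover have "(\<Inter>c. fst (g c), \<Inter>c. snd (g c)) \<in> D"
      unfolding D_def using g(1) by (intro image_eqI[of _ _ g]) auto
    moreover have "(\<Inter>c. fst (g c)) \<subseteq> T" "T \<subseteq> (\<Inter>c. snd (g c))"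
      unfolding T using g(2,3) by blast+
    ultimately show "\<exists>p\<in>D. fst p \<subseteq> T \<and> T \<subseteq> snd p \<and>
        (\<forall>\<mu>\<in>N. measure \<mu> (snd p - fst p) \<le> real CARD('c) * \<delta>)"
      by (intro bexI[of _ "(\<Inter>c. fst (g c), \<Inter>c. snd (g c))"]) simp_all
  qed
qed

lemma eventually_measure_vanishing:
  assumes "finite N" and N: "\<And>\<mu>. \<mu> \<in> N \<Longrightarrow> prob_space \<mu> \<and> sets \<mu> = sets borel"
    and "decseq A" "\<And>n. A n \<in> sets borel" "(\<Inter>n. A n) = {}" "0 < \<delta>"
  shows "\<forall>\<^sub>F n in sequentially. \<forall>\<mu>\<in>N. measure \<mu> (A n) \<le> \<delta>"
proof (rule eventually_ball_finite[OF \<open>finite N\<close>], rule ballI)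
  fix \<mu> assume "\<mu> \<in> N"
  then interpret \<mu>: prob_space \<mu> using N by blast
  have "(\<lambda>n. measure \<mu> (A n)) \<longlonglongrightarrow> measure \<mu> (\<Inter>n. A n)"
    using assms(3,4) N[OF \<open>\<mu> \<in> N\<close>] by (intro \<mu>.finite_Lim_measure_decseq) auto
  then have "\<forall>\<^sub>F n in sequentially. measure \<mu> (A n) < \<delta>"
    using assms(5,6) by (intro order_tendstoD) auto
  then show "\<forall>\<^sub>F n in sequentially. measure \<mu> (A n) \<le> \<delta>"
    by (rule eventually_mono) auto
qed

text \<open>The value of \<open>f\<close> may have atoms, so the levels cannot simply be cut into short closed
  intervals. But the gaps \<open>{x - d < f < x}\<close> and \<open>{x < f < x + d}\<close> decrease to the empty set as
  \<open>d\<close> tends to zero. So close to each level \<open>x\<close>, one bracket serves the levels just below \<open>x\<close> and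
  one those from \<open>x\<close> on. Compactness of an interval, in the form of Bolzano's bisection principle,
  makes finitely many of them enough, and the tails beyond the interval need one bracket each.\<close>

lemma finitely_bracketed_sublevels:
  fixes f :: "'a::topological_space \<Rightarrow> real"
  assumes f[measurable]: "f \<in> borel_measurable borel"
    and "finite N" and N: "\<And>\<mu>. \<mu> \<in> N \<Longrightarrow> prob_space \<mu> \<and> sets \<mu> = sets borel" and "0 < \<delta>"
  shows "finitely_bracketed N \<delta> (range (\<lambda>t. {y. f y \<le> t}))"
proof -
  let ?H = "\<lambda>t. {y. f y \<le> t}"
  note vanish = eventually_measure_vanishing[OF \<open>finite N\<close> N, rotated -1, OF \<open>0 < \<delta>\<close>]
  have fm: "{y. f y \<le> t} \<in> sets borel" "{y. f y < t} \<in> sets borel" "{y. t < f y} \<in> sets borel" for t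
    by measurable
  have "\<forall>\<^sub>F n in sequentially. \<forall>\<mu>\<in>N. measure \<mu> {y. f y \<le> - real n} \<le> \<delta>"
  proof (rule vanish)
    have "\<exists>n. - real n < f y" for y
      using reals_Archimedean2[of "- f y"] by (auto simp: minus_less_iff)
    then show "(\<Inter>n. {y. f y \<le> - real n}) = {}"
      by (simp add: set_eq_iff not_le)
  qed (auto simp: decseq_def fm)
  moreover have "\<forall>\<^sub>F n in sequentially. \<forall>\<mu>\<in>N. measure \<mu> {y. real n < f y} \<le> \<delta>"
  proof (rule vanish)
    have "\<exists>n. f y \<le> real n" for y by (rule real_arch_simple)
    then show "(\<Inter>n. {y. real n < f y}) = {}"
      by (simp add: set_eq_iff not_less)
  qed (auto simp: decseq_def fm)
  ultimately have "\<forall>\<^sub>F n in sequentially. (\<forall>\<mu>\<in>N. measure \<mu> {y. f y \<le> - real n} \<le> \<delta>) \<and>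
      (\<forall>\<mu>\<in>N. measure \<mu> {y. real n < f y} \<le> \<delta>)"
    by (rule eventually_conj)
  then obtain n where lo: "\<And>\<mu>. \<mu> \<in> N \<Longrightarrow> measure \<mu> {y. f y \<le> - real n} \<le> \<delta>"
    and hi: "\<And>\<mu>. \<mu> \<in> N \<Longrightarrow> measure \<mu> {y. real n < f y} \<le> \<delta>"
    by (auto dest!: eventually_happens'[OF sequentially_bot])
  have "finitely_bracketed N \<delta> (?H ` {..- real n})"
    by (rule finitely_bracketed_single[of "{}" "{y. f y \<le> - real n}"]) (auto simp: lo fm)
  moreover have "finitely_bracketed N \<delta> (?H ` {real n..})"
  proof (rule finitely_bracketed_single[of "{y. f y \<le> real n}" UNIV])
    have "UNIV - {y. f y \<le> real n} = {y. real n < f y}" by auto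
    then show "measure \<mu> (UNIV - {y. f y \<le> real n}) \<le> \<delta>" if "\<mu> \<in> N" for \<mu>
      using hi[OF that] by simp
  qed (auto simp: fm)
  moreover have "finitely_bracketed N \<delta> (?H ` {- real n..real n})"
  proof (rule Bolzano[where P = "\<lambda>a b. finitely_bracketed N \<delta> (?H ` {a..b})"])
    fix a b c :: real
    assume *: "finitely_bracketed N \<delta> (?H ` {a..b})" "finitely_bracketed N \<delta> (?H ` {b..c})"
      and "a \<le> b" "b \<le> c"
    then have "{a..c} = {a..b} \<union> {b..c}" by auto
    then show "finitely_bracketed N \<delta> (?H ` {a..c})"
      using finitely_bracketed_Un[OF *] by (simp add: image_Un)
  next
    fix x :: real
    have "\<forall>\<^sub>F n in sequentially. \<forall>\<mu>\<in>N. measure \<mu> {y. x - 1 / Suc n < f y \<and> f y < x} \<le> \<delta>"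
    proof (rule vanish)
      show "decseq (\<lambda>n. {y. x - 1 / Suc n < f y \<and> f y < x})"
        by (intro decseq_SucI) (auto simp: field_simps elim!: order.strict_trans1[rotated])
      have "\<exists>n. \<not> (x - 1 / Suc n < f y \<and> f y < x)" for y
      proof (cases "f y < x")
        case True
        have "0 < x - f y" using True by simp
        then obtain n where "1 / real (Suc n) < x - f y" by (rule nat_approx_posE)
        then show ?thesis by (intro exI[of _ n]) auto
      qed simp
      then show "(\<Inter>n. {y. x - 1 / Suc n < f y \<and> f y < x}) = {}"
        by blast
    qed measurable
    moreover have "\<forall>\<^sub>F n in sequentially. \<forall>\<mu>\<in>N. measure \<mu> {y. x < f y \<and> f y < x + 1 / Suc n} \<le> \<delta>"
    proof (rule vanish)
      show "decseq (\<lambda>n. {y. x < f y \<and> f y < x + 1 / Suc n})"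
        by (intro decseq_SucI) (auto simp: field_simps elim!: order.strict_trans2)
      have "\<exists>n. \<not> (x < f y \<and> f y < x + 1 / Suc n)" for y
      proof (cases "x < f y")
        case True
        have "0 < f y - x" using True by simp
        then obtain n where "1 / real (Suc n) < f y - x" by (rule nat_approx_posE)
        then show ?thesis by (intro exI[of _ n]) auto
      qed simp
      then show "(\<Inter>n. {y. x < f y \<and> f y < x + 1 / Suc n}) = {}"
        by blast
    qed measurable
    ultimately have "\<forall>\<^sub>F n in sequentially.
        (\<forall>\<mu>\<in>N. measure \<mu> {y. x - 1 / Suc n < f y \<and> f y < x} \<le> \<delta>) \<and>
        (\<forall>\<mu>\<in>N. measure \<mu> {y. x < f y \<and> f y < x + 1 / Suc n} \<le> \<delta>)"
      by (rule eventually_conj)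
    then obtain n where n: "\<And>\<mu>. \<mu> \<in> N \<Longrightarrow> measure \<mu> {y. x - 1 / Suc n < f y \<and> f y < x} \<le> \<delta>"
      "\<And>\<mu>. \<mu> \<in> N \<Longrightarrow> measure \<mu> {y. x < f y \<and> f y < x + 1 / Suc n} \<le> \<delta>"
      by (auto dest!: eventually_happens'[OF sequentially_bot])
    define d where "d = 1 / real (Suc n)"
    have "d > 0" and left: "\<And>\<mu>. \<mu> \<in> N \<Longrightarrow> measure \<mu> {y. x - d < f y \<and> f y < x} \<le> \<delta>"
      and right: "\<And>\<mu>. \<mu> \<in> N \<Longrightarrow> measure \<mu> {y. x < f y \<and> f y < x + d} \<le> \<delta>"
      using n by (simp_all add: d_def)
    have "finitely_bracketed N \<delta> (?H ` {a..b})" if "a \<le> x" "x \<le> b" "b - a < d" for a b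
    proof -
      have "finitely_bracketed N \<delta> (?H ` {a..<x})"
      proof (rule finitely_bracketed_single[of "{y. f y \<le> x - d}" "{y. f y < x}"])
        have "{y. f y < x} - {y. f y \<le> x - d} = {y. x - d < f y \<and> f y < x}" by auto
        then show "measure \<mu> ({y. f y < x} - {y. f y \<le> x - d}) \<le> \<delta>" if "\<mu> \<in> N" for \<mu>
          using left[OF that] by simp
      qed (use that in \<open>auto simp: fm\<close>)
      moreover have "finitely_bracketed N \<delta> (?H ` {x..b})"
      proof (rule finitely_bracketed_single[of "{y. f y \<le> x}" "{y. f y < x + d}"])
        have "{y. f y < x + d} - {y. f y \<le> x} = {y. x < f y \<and> f y < x + d}" by auto
        then show "measure \<mu> ({y. f y < x + d} - {y. f y \<le> x}) \<le> \<delta>" if "\<mu> \<in> N" for \<mu>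
          using right[OF that] by simp
      qed (use that in \<open>auto simp: fm\<close>)
      ultimately have "finitely_bracketed N \<delta> (?H ` ({a..<x} \<union> {x..b}))"
        by (simp add: image_Un finitely_bracketed_Un)
      moreover have "{a..<x} \<union> {x..b} = {a..b}" using that by auto
      ultimately show ?thesis by simp
    qed
    then show "\<exists>d>0. \<forall>a b. a \<le> x \<and> x \<le> b \<and> b - a < d \<longrightarrow> finitely_bracketed N \<delta> (?H ` {a..b})"
      using \<open>d > 0\<close> by blast
  qed simp
  ultimately have "finitely_bracketed N \<delta> (?H ` ({..- real n} \<union> {- real n..real n} \<union> {real n..}))"
    by (simp add: image_Un finitely_bracketed_Un)
  moreover have "{..- real n} \<union> {- real n..real n} \<union> {real n..} = UNIV" by auto
  ultimately show ?thesis by simp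
qed

text \<open>An orthant is a finite intersection of sublevel sets of the coordinates, so it suffices to spend
  an equal share of \<open>\<delta>\<close> on each coordinate.\<close>

lemma finitely_bracketed_orthants:
  fixes N :: "(real ^ 'p) measure set"
  assumes "finite N" "\<And>\<mu>. \<mu> \<in> N \<Longrightarrow> prob_space \<mu> \<and> sets \<mu> = sets borel" "0 < \<delta>"
  shows "finitely_bracketed N \<delta> (range (\<lambda>x. {..x}))"
proof -
  have "finitely_bracketed N (real CARD('p) * (\<delta> / real CARD('p)))
      {\<Inter>c. S c | S. \<forall>c::'p. S c \<in> range (\<lambda>t. {y::real^'p. y $ c \<le> t})}"
  proof (intro finitely_bracketed_INT finitely_bracketed_sublevels assms)
    show "(\<lambda>y::real^'p. y $ c) \<in> borel_measurable borel" for c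
      by (intro borel_measurable_continuous_onI continuous_intros)
  qed (use \<open>0 < \<delta>\<close> in auto)
  moreover have "{..x} = (\<Inter>c. {y. y $ c \<le> x $ c})" for x :: "real ^ 'p"
    by (auto simp: less_eq_vec_def)
  then have "\<exists>S. {..x} = (\<Inter>c. S c) \<and> (\<forall>c::'p. S c \<in> range (\<lambda>t. {y::real^'p. y $ c \<le> t}))"
    for x :: "real ^ 'p"
    by (intro exI[of _ "\<lambda>c. {y. y $ c \<le> x $ c}"]) auto
  then have "range (\<lambda>x. {..x}) \<subseteq> {\<Inter>c. S c | S. \<forall>c::'p. S c \<in> range (\<lambda>t. {y::real^'p. y $ c \<le> t})}"
    by auto
  ultimately show ?thesis
    by (auto intro: finitely_bracketed_subset)
qed

section \<open>Uniform laws of large numbers for independent observations\<close>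

text \<open>Hoeffding's inequality bounds the probability of an average deviating by \<open>e\<close> after \<open>j\<close> steps
  by \<open>2 exp (- 2 e\<^sup>2) ^ j\<close>, which is summable, so Borel--Cantelli applies. The laws may
  vary with \<open>i\<close>, because each average is compared with its own expectation.\<close>

lemma (in prob_space) AE_average_of_indicators:
  fixes Y :: "nat \<Rightarrow> 'a \<Rightarrow> 'b::topological_space"
  assumes indep: "\<And>n. indep_vars (\<lambda>_. borel) Y {1..n}" and U[measurable]: "U \<in> sets borel"
  shows "AE w in M. (\<lambda>j. (\<Sum>i=1..j. indicat_real U (Y i w)) / real j
    - (\<Sum>i=1..j. measure (distr M borel (Y i)) U) / real j) \<longlonglongrightarrow> 0"
proof -
  define Z where "Z i w = indicat_real U (Y i w)" for i w
  define p where "p i = measure (distr M borel (Y i)) U" for i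
  have Y: "Y i \<in> measurable M borel" if "i \<ge> 1" for i
    using indep[of i] that unfolding indep_vars_def by auto
  have Z: "Z i \<in> borel_measurable M" if "i \<ge> 1" for i
    unfolding Z_def using measurable_compose[OF Y[OF that], of "indicat_real U" borel] by simp
  have EZ: "expectation (Z i) = p i" if "i \<ge> 1" for i
  proof -
    have "p i = (\<integral>y. indicat_real U y \<partial>distr M borel (Y i))"
      unfolding p_def by simp
    also have "\<dots> = expectation (Z i)"
      unfolding Z_def using Y[OF that] by (subst integral_distr) auto
    finally show ?thesis by simp
  qed
  have tail: "AE w in M. \<forall>\<^sub>F j in sequentially. \<bar>(\<Sum>i=1..j. Z i w) - (\<Sum>i=1..j. p i)\<bar> < e * real j"
    if "e > 0" for e
  proof -
    define A where "A j = {w\<in>space M. e * real j \<le> \<bar>(\<Sum>i=1..j. Z i w) - (\<Sum>i=1..j. p i)\<bar>}" for j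
    have A: "A j \<in> sets M" for j
    proof -
      have [measurable]: "(\<lambda>w. \<Sum>i=1..j. Z i w) \<in> borel_measurable M"
        by (intro borel_measurable_sum Z) auto
      show ?thesis unfolding A_def by measurable
    qed
    \<comment> \<open>Hoeffding's inequality divides by the number of summands; for \<open>j = 0\<close> the bound is trivial.\<close>
    have bound: "prob (A j) \<le> 2 * exp (- 2 * e\<^sup>2) ^ j" for j
    proof (cases "j = 0")
      case True
      then show ?thesis using order_trans[OF prob_le_1[of "A j"], of 2] by simp
    next
      case False
      interpret H: Hoeffding_ineq M "{1..j}" Z "\<lambda>_. 0" "\<lambda>_. 1" "\<Sum>i=1..j. p i"
      proof unfold_locales
        show "indep_vars (\<lambda>_. borel) Z {1..j}"
          unfolding Z_def by (rule indep_vars_compose2[OF indep]) simp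
        show "(\<Sum>i=1..j. p i) \<equiv> (\<Sum>i=1..j. expectation (Z i))"
          by (rule eq_reflection, rule sum.cong) (auto simp: EZ)
      qed (auto simp: Z_def indicator_def)
      have "prob (A j) \<le> 2 * exp (- 2 * (e * real j)\<^sup>2 / (\<Sum>i=1..j. (1 - 0)\<^sup>2))"
        unfolding A_def by (rule H.Hoeffding_ineq_abs_ge) (use \<open>e > 0\<close> False in auto)
      also have "- 2 * (e * real j)\<^sup>2 / (\<Sum>i=1..j. (1 - 0)\<^sup>2) = real j * (- 2 * e\<^sup>2)"
        using False by (simp add: power2_eq_square)
      finally show ?thesis unfolding exp_of_nat_mult .
    qed
    have "summable (\<lambda>j. 2 * exp (- 2 * e\<^sup>2) ^ j)"
      using \<open>e > 0\<close> by (intro summable_mult summable_geometric) auto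
    then have "summable (\<lambda>j. prob (A j))"
      by (rule summable_comparison_test') (use bound in auto)
    then have "AE w in M. \<forall>\<^sub>F j in sequentially. w \<in> space M - A j"
      using A by (intro borel_cantelli_AE1) (auto simp: emeasure_eq_measure)
    then show ?thesis
      by (rule eventually_mono) (auto simp: A_def not_le elim!: eventually_mono)
  qed
  have "AE w in M. \<forall>k. \<forall>\<^sub>F j in sequentially.
      \<bar>(\<Sum>i=1..j. Z i w) - (\<Sum>i=1..j. p i)\<bar> < 1 / real (Suc k) * real j"
    unfolding AE_all_countable by (intro allI tail) simp
  then show ?thesis
  proof (rule eventually_mono)
    fix w assume w: "\<forall>k. \<forall>\<^sub>F j in sequentially.
      \<bar>(\<Sum>i=1..j. Z i w) - (\<Sum>i=1..j. p i)\<bar> < 1 / real (Suc k) * real j"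
    have "(\<lambda>j. (\<Sum>i=1..j. Z i w) / real j - (\<Sum>i=1..j. p i) / real j) \<longlonglongrightarrow> 0"
    proof (rule tendstoI)
      fix e :: real assume "e > 0"
      then obtain k where k: "1 / real (Suc k) < e" using nat_approx_posE by blast
      have "\<forall>\<^sub>F j in sequentially. j > 0" by (rule eventually_gt_at_top)
      with w[rule_format, of k]
      show "\<forall>\<^sub>F j in sequentially. dist ((\<Sum>i=1..j. Z i w) / real j - (\<Sum>i=1..j. p i) / real j) 0 < e"
      proof eventually_elim
        case (elim j)
        have "\<bar>(\<Sum>i=1..j. Z i w) - (\<Sum>i=1..j. p i)\<bar> / real j < 1 / real (Suc k)"
          using elim by (simp add: pos_divide_less_eq)
        then have "\<bar>((\<Sum>i=1..j. Z i w) - (\<Sum>i=1..j. p i)) / real j\<bar> < e"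
          using k elim by (simp add: abs_divide)
        then show ?case by (simp add: diff_divide_distrib)
      qed
    qed
    then show "(\<lambda>j. (\<Sum>i=1..j. indicat_real U (Y i w)) / real j
        - (\<Sum>i=1..j. measure (distr M borel (Y i)) U) / real j) \<longlonglongrightarrow> 0"
      unfolding Z_def p_def .
  qed
qed

text \<open>For a bracket \<open>L \<subseteq> S \<subseteq> U\<close> with gap \<open>\<delta>\<close>, both the empirical and the averaged measure of
  \<open>S\<close> lie between those of \<open>L\<close> and \<open>U\<close>. The averaged measures of \<open>L\<close> and \<open>U\<close> differ by at most
  \<open>\<delta>\<close>, and eventually the empirical ones are within \<open>\<delta>\<close> of them. This gives the error bound
  \<open>2 \<delta>\<close> for all \<open>S\<close> in the class.\<close>

lemma (in prob_space) uniform_law_of_large_numbers: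
  fixes Y :: "nat \<Rightarrow> 'a \<Rightarrow> 'b::topological_space"
  assumes indep: "\<And>n. indep_vars (\<lambda>_. borel) Y {1..n}"
    and br: "\<And>\<delta>. \<delta> > 0 \<Longrightarrow> finitely_bracketed ((\<lambda>i. distr M borel (Y i)) ` {1..}) \<delta> \<C>"
    and \<C>: "\<C> \<subseteq> sets borel"
  shows "AE w in M. uniform_limit \<C>
    (\<lambda>j S. (\<Sum>i=1..j. indicat_real S (Y i w)) / real j
      - (\<Sum>i=1..j. measure (distr M borel (Y i)) S) / real j) (\<lambda>_. 0) sequentially"
proof -
  define P where "P i = distr M borel (Y i)" for i
  define h where "h w j S = (\<Sum>i=1..j. indicat_real S (Y i w)) / real j" for w j S
  define q where "q j S = (\<Sum>i=1..j. measure (P i) S) / real j" for j S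
  have Y: "Y i \<in> measurable M borel" if "i \<ge> 1" for i
    using indep[of i] that unfolding indep_vars_def by auto
  have P: "prob_space (P i)" "sets (P i) = sets borel" if "i \<ge> 1" for i
    unfolding P_def using prob_space_distr[OF Y[OF that]] by auto
  have h_mono: "h w j S \<le> h w j T" if "S \<subseteq> T" for w j S T
    unfolding h_def using that by (intro divide_right_mono sum_mono) (auto simp: indicator_def)
  have q_mono: "q j S \<le> q j T" if "S \<subseteq> T" "T \<in> sets borel" for j S T
    unfolding q_def
  proof (intro divide_right_mono sum_mono)
    fix i assume i: "i \<in> {1..j}"
    then interpret Q: prob_space "P i" using P by simp
    show "measure (P i) S \<le> measure (P i) T"
      using that P(2)[of i] i by (intro Q.finite_measure_mono) auto
  qed simp
  have q_close: "q j U \<le> q j L + \<delta>"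
    if "L \<subseteq> U" "L \<in> sets borel" "U \<in> sets borel" "\<And>i. i \<ge> 1 \<Longrightarrow> measure (P i) (U - L) \<le> \<delta>" "\<delta> > 0"
    for j L U \<delta>
  proof -
    have "(\<Sum>i=1..j. measure (P i) U) \<le> (\<Sum>i=1..j. measure (P i) L + \<delta>)"
    proof (rule sum_mono)
      fix i assume i: "i \<in> {1..j}"
      then interpret Q: prob_space "P i" using P by simp
      have "measure (P i) (U - L) = measure (P i) U - measure (P i) L"
        using that P(2)[of i] i by (intro Q.finite_measure_Diff) auto
      then show "measure (P i) U \<le> measure (P i) L + \<delta>" using that(4)[of i] i by simp
    qed
    then have "q j U \<le> (\<Sum>i=1..j. measure (P i) L + \<delta>) / real j"
      unfolding q_def by (intro divide_right_mono) auto
    also have "\<dots> \<le> q j L + \<delta>"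
      using that(5) unfolding q_def by (auto simp: sum.distrib add_divide_distrib)
    finally show ?thesis .
  qed
  have approx: "AE w in M. \<forall>\<^sub>F j in sequentially. \<forall>S\<in>\<C>. \<bar>h w j S - q j S\<bar> \<le> 2 * \<delta>" if "\<delta> > 0" for \<delta>
  proof -
    from br[OF that, folded P_def] obtain B where B: "finite B" "B \<subseteq> sets borel \<times> sets borel"
      and cov: "\<And>S. S \<in> \<C> \<Longrightarrow> \<exists>p\<in>B. fst p \<subseteq> S \<and> S \<subseteq> snd p \<and>
        (\<forall>\<mu>\<in>P ` {1..}. measure \<mu> (snd p - fst p) \<le> \<delta>)"
      unfolding finitely_bracketed_def by (elim exE conjE) (rule that, assumption, assumption, erule bspec)
    have "AE w in M. \<forall>T\<in>fst ` B \<union> snd ` B. (\<lambda>j. h w j T - q j T) \<longlonglongrightarrow> 0"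
      unfolding h_def q_def P_def
      by (intro AE_finite_allI AE_average_of_indicators indep) (use B in auto)
    then show ?thesis
    proof (rule eventually_mono)
      fix w assume w: "\<forall>T\<in>fst ` B \<union> snd ` B. (\<lambda>j. h w j T - q j T) \<longlonglongrightarrow> 0"
      have "\<forall>\<^sub>F j in sequentially. \<forall>T\<in>fst ` B \<union> snd ` B. dist (h w j T - q j T) 0 < \<delta>"
        by (rule eventually_ball_finite) (use B(1) w that tendstoD in blast)+
      then show "\<forall>\<^sub>F j in sequentially. \<forall>S\<in>\<C>. \<bar>h w j S - q j S\<bar> \<le> 2 * \<delta>"
      proof (rule eventually_mono, intro ballI)
        fix j S assume j: "\<forall>T\<in>fst ` B \<union> snd ` B. dist (h w j T - q j T) 0 < \<delta>" and "S \<in> \<C>"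
        from cov[OF this(2)] obtain L U where LU: "(L, U) \<in> B" "L \<subseteq> S" "S \<subseteq> U"
          "\<And>i. i \<ge> 1 \<Longrightarrow> measure (P i) (U - L) \<le> \<delta>" by force
        have m: "L \<in> sets borel" "U \<in> sets borel" "S \<in> sets borel" using LU(1) B(2) \<C> \<open>S \<in> \<C>\<close> by auto
        have "L \<in> fst ` B" "U \<in> snd ` B" using LU(1) by force+
        with j have "\<bar>h w j L - q j L\<bar> < \<delta>" "\<bar>h w j U - q j U\<bar> < \<delta>" by (auto simp: dist_real_def)
        moreover have "q j U \<le> q j L + \<delta>" using LU m that by (intro q_close) auto
        moreover have "q j L \<le> q j S" "q j S \<le> q j U" "h w j L \<le> h w j S" "h w j S \<le> h w j U"
          using LU m by (auto intro!: q_mono h_mono)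
        ultimately show "\<bar>h w j S - q j S\<bar> \<le> 2 * \<delta>" by linarith
      qed
    qed
  qed
  have "AE w in M. \<forall>k. \<forall>\<^sub>F j in sequentially. \<forall>S\<in>\<C>. \<bar>h w j S - q j S\<bar> \<le> 2 * (1 / real (Suc k))"
    unfolding AE_all_countable by (intro allI approx) simp
  then show ?thesis
    unfolding h_def[symmetric] P_def[symmetric] q_def[symmetric]
  proof (rule eventually_mono)
    fix w assume w: "\<forall>k. \<forall>\<^sub>F j in sequentially. \<forall>S\<in>\<C>. \<bar>h w j S - q j S\<bar> \<le> 2 * (1 / real (Suc k))"
    show "uniform_limit \<C> (\<lambda>j S. h w j S - q j S) (\<lambda>_. 0) sequentially"
    proof (rule uniform_limitI)
      fix e :: real assume "e > 0"
      then obtain k where k: "1 / real (Suc k) < e / 2" using nat_approx_posE[of "e / 2"] by auto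
      show "\<forall>\<^sub>F j in sequentially. \<forall>S\<in>\<C>. dist (h w j S - q j S) 0 < e"
        using w[rule_format, of k] by (rule eventually_mono) (use k in \<open>fastforce simp: dist_real_def\<close>)
    qed
  qed
qed

lemma (in prob_space) glivenko_cantelli:
  fixes Y :: "nat \<Rightarrow> 'a \<Rightarrow> real ^ 'p"
  assumes indep: "\<And>n. indep_vars (\<lambda>_. borel) Y {1..n}"
    and fin: "finite ((\<lambda>i. distr M borel (Y i)) ` {1..})"
  shows "AE w in M. uniform_limit UNIV
    (\<lambda>j x. (\<Sum>i=1..j. of_bool (Y i w \<le> x)) / real j
      - (\<Sum>i=1..j. mcdf (distr M borel (Y i)) x) / real j) (\<lambda>_. 0) sequentially"
proof -
  have Y: "Y i \<in> measurable M borel" if "i \<ge> 1" for i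
    using indep[of i] that unfolding indep_vars_def by auto
  have "AE w in M. uniform_limit (range (\<lambda>x::real^'p. {..x}))
    (\<lambda>j S. (\<Sum>i=1..j. indicat_real S (Y i w)) / real j
      - (\<Sum>i=1..j. measure (distr M borel (Y i)) S) / real j) (\<lambda>_. 0) sequentially"
    using prob_space_distr[OF Y]
    by (intro uniform_law_of_large_numbers finitely_bracketed_orthants indep fin) auto
  then show ?thesis
    by (rule eventually_mono)
       (simp add: uniform_limit_iff mcdf_def indicator_def of_bool_def)
qed

section \<open>Distribution functions and the Kolmogorov distance\<close>

text \<open>The orthants form an intersection-stable generator of the Borel sets, so a law is
  determined by its distribution function. This turns the assumption that each observation has one
  of two given distribution functions into the statement that only two laws occur.\<close>

lemma measure_eqI_mcdf:
  fixes \<mu> \<nu> :: "(real ^ 'p) measure"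
  assumes "prob_space \<mu>" "sets \<mu> = sets borel" "prob_space \<nu>" "sets \<nu> = sets borel"
    and "mcdf \<mu> = mcdf \<nu>"
  shows "\<mu> = \<nu>"
proof -
  interpret \<mu>: prob_space \<mu> by fact
  interpret \<nu>: prob_space \<nu> by fact
  have borel: "sets borel = sigma_sets UNIV (range (\<lambda>a::real^'p. {..a}))"
    by (subst borel_eq_atMost) simp
  show ?thesis
  proof (rule measure_eqI_generator_eq[where \<Omega> = UNIV and E = "range (\<lambda>a. {..a})"
        and A = "\<lambda>n. {..\<chi> c. real n}"])
    have "{..a} \<inter> {..b} = {..inf a b}" for a b :: "real^'p" by auto
    then show "Int_stable (range (\<lambda>a::real^'p. {..a}))" unfolding Int_stable_def by auto
    show "emeasure \<mu> A = emeasure \<nu> A" if "A \<in> range (\<lambda>a. {..a})" for A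
      using that fun_cong[OF assms(5)]
      by (auto simp: mcdf_def \<mu>.emeasure_eq_measure \<nu>.emeasure_eq_measure)
    have "\<exists>n. x \<le> (\<chi> c. real n)" for x :: "real^'p"
    proof -
      obtain n where "Max (range (\<lambda>c. x $ c)) \<le> real n" using real_arch_simple by blast
      then have "x $ c \<le> real n" for c by (meson Max_ge finite_imageI finite rangeI order_trans)
      then show ?thesis by (auto simp: less_eq_vec_def)
    qed
    then show "(\<Union>n. {..(\<chi> c. real n) :: real^'p}) = UNIV" by auto
  qed (use assms borel in auto)
qed

lemma mcdf_unit_interval:
  assumes "prob_space N" shows "mcdf N x \<in> {0..1}"
proof -
  interpret prob_space N by fact
  show ?thesis by (simp add: mcdf_def)
qed

lemma distribution_functions_unit_interval:
  "F \<in> distribution_functions \<Longrightarrow> F x \<in> {0..1}"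
  by (auto simp: distribution_functions_def simp del: atLeastAtMost_iff intro: mcdf_unit_interval)

lemma empirical_cdf_unit_interval: "empirical_cdf X A w x \<in> {0..1}"
proof -
  have "(\<Sum>i\<in>A. of_bool (X i w \<le> x) :: real) \<le> (\<Sum>i\<in>A. 1)" by (intro sum_mono) auto
  then have "(\<Sum>i\<in>A. of_bool (X i w \<le> x)) / real (card A) \<le> 1"
    by (intro divide_le_eq_1[THEN iffD2]) (auto simp: le_less)
  moreover have "(\<Sum>i\<in>A. of_bool (X i w \<le> x)) / real (card A) \<ge> 0"
    by (intro divide_nonneg_nonneg sum_nonneg) auto
  ultimately show ?thesis by (simp add: empirical_cdf_def)
qed

lemma abs_diff_le_kolmogorov_dist:
  assumes "\<And>x. F x \<in> {0..1}" "\<And>x. H x \<in> {0..1}"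
  shows "\<bar>F x - H x\<bar> \<le> kolmogorov_dist F H"
  unfolding kolmogorov_dist_def
proof (rule cSUP_upper)
  have "\<bar>F y - H y\<bar> \<le> 1" for y using assms[of y] by auto
  then show "bdd_above (range (\<lambda>x. \<bar>F x - H x\<bar>))" by (intro bdd_aboveI2)
qed simp

lemma kolmogorov_dist_le:
  assumes "\<And>x. \<bar>F x - H x\<bar> \<le> c" shows "kolmogorov_dist F H \<le> c"
  unfolding kolmogorov_dist_def by (rule cSUP_least) (use assms in auto)

lemma kolmogorov_dist_nonneg:
  assumes "\<And>x. F x \<in> {0..1}" "\<And>x. H x \<in> {0..1}"
  shows "0 \<le> kolmogorov_dist F H"
  using order_trans[OF abs_ge_zero abs_diff_le_kolmogorov_dist[of F H undefined]] assms by blast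

lemma kolmogorov_dist_triangle:
  assumes "\<And>x. F x \<in> {0..1}" "\<And>x. K x \<in> {0..1}" "\<And>x. H x \<in> {0..1}"
  shows "kolmogorov_dist F H \<le> kolmogorov_dist F K + kolmogorov_dist K H"
proof (rule kolmogorov_dist_le)
  show "\<bar>F x - H x\<bar> \<le> kolmogorov_dist F K + kolmogorov_dist K H" for x
    using abs_diff_le_kolmogorov_dist[of F K x] abs_diff_le_kolmogorov_dist[of K H x] assms by force
qed

lemma INF_kolmogorov_dist_le_dist:
  assumes "\<theta> \<in> \<Theta>" "\<And>\<theta> x. \<theta> \<in> \<Theta> \<Longrightarrow> F \<theta> x \<in> {0..1}" "\<And>x. H x \<in> {0..1}"
  shows "(INF \<theta>\<in>\<Theta>. kolmogorov_dist H (F \<theta>)) \<le> kolmogorov_dist H (F \<theta>)"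
proof (rule cINF_lower)
  show "bdd_below ((\<lambda>\<theta>. kolmogorov_dist H (F \<theta>)) ` \<Theta>)"
    using assms by (intro bdd_belowI2[where m = 0] kolmogorov_dist_nonneg) auto
qed fact

text \<open>The distance to a family is 1-Lipschitz: this transfers the positive infimum for the mixture to
  empirical distribution functions close to it.\<close>

lemma INF_kolmogorov_dist_triangle:
  assumes "\<Theta> \<noteq> {}" "\<And>\<theta> x. \<theta> \<in> \<Theta> \<Longrightarrow> F \<theta> x \<in> {0..1}"
    and "\<And>x. H x \<in> {0..1}" "\<And>x. K x \<in> {0..1}"
  shows "(INF \<theta>\<in>\<Theta>. kolmogorov_dist K (F \<theta>))
    \<le> kolmogorov_dist H K + (INF \<theta>\<in>\<Theta>. kolmogorov_dist H (F \<theta>))"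
proof -
  have sym: "kolmogorov_dist H K = kolmogorov_dist K H"
    by (simp add: kolmogorov_dist_def abs_minus_commute)
  have "(INF \<theta>\<in>\<Theta>. kolmogorov_dist K (F \<theta>)) - kolmogorov_dist H K
      \<le> (INF \<theta>\<in>\<Theta>. kolmogorov_dist H (F \<theta>))"
  proof (rule cINF_greatest)
    fix \<theta> assume \<theta>: "\<theta> \<in> \<Theta>"
    have "(INF \<theta>\<in>\<Theta>. kolmogorov_dist K (F \<theta>)) \<le> kolmogorov_dist K (F \<theta>)"
      using \<theta> assms by (intro INF_kolmogorov_dist_le_dist) auto
    also have "\<dots> \<le> kolmogorov_dist K H + kolmogorov_dist H (F \<theta>)"
      using \<theta> assms by (intro kolmogorov_dist_triangle) auto
    finally show "(INF \<theta>\<in>\<Theta>. kolmogorov_dist K (F \<theta>)) - kolmogorov_dist H K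
      \<le> kolmogorov_dist H (F \<theta>)" using sym by simp
  qed fact
  then show ?thesis by simp
qed

lemma convex_combination_unit_interval:
  fixes \<alpha> a b :: real
  assumes "0 \<le> \<alpha>" "\<alpha> \<le> 1" "a \<in> {0..1}" "b \<in> {0..1}"
  shows "(1 - \<alpha>) * a + \<alpha> * b \<in> {0..1}"
  using assms convex_bound_le[of a 1 b "1 - \<alpha>" \<alpha>] by auto

section \<open>Empirical distributions along a subsequence\<close>

text \<open>This is the grouping theorem \<open>indep_vars_restrict\<close> for the singleton groups \<open>{h i}\<close>.\<close>

lemma (in prob_space) indep_vars_reindex:
  assumes "indep_vars M' X (h ` I)" "inj_on h I"
  shows "indep_vars (\<lambda>i. M' (h i)) (\<lambda>i. X (h i)) I"
proof -
  have "indep_vars (\<lambda>i. PiM {h i} M') (\<lambda>i w. restrict (\<lambda>j. X j w) {h i}) I"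
    using assms
    by (intro indep_vars_restrict[where I = "h ` I"]) (auto simp: disjoint_family_on_def inj_on_def)
  then have "indep_vars (\<lambda>i. M' (h i)) (\<lambda>i w. restrict (\<lambda>j. X j w) {h i} (h i)) I"
    by (rule indep_vars_compose2[where Y = "\<lambda>i v. v (h i)"]) (rule measurable_component_singleton, simp)
  then show ?thesis by simp
qed

lemma index_seqs_ge_1:
  assumes "k \<in> index_seqs" "i \<ge> 1" shows "k i \<ge> 1"
proof (cases "i = 1")
  case False
  have "strict_mono_on {1..} k" using assms(1) by (simp add: index_seqs_def)
  then have "k 1 < k i" by (rule strict_mono_onD) (use assms(2) False in auto)
  then show ?thesis using assms(1) by (simp add: index_seqs_def)
qed (use assms in \<open>simp add: index_seqs_def\<close>)

lemma index_seqs_inj: "k \<in> index_seqs \<Longrightarrow> inj_on k {1..j}"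
  by (rule inj_on_subset[OF strict_mono_on_imp_inj_on[where A = "{1..}"]]) (auto simp: index_seqs_def)

lemma empirical_cdf_initial_indices:
  assumes "k \<in> index_seqs"
  shows "empirical_cdf X (initial_indices k m n) w x
    = (\<Sum>i=1..m n. of_bool (X (k i) w \<le> x)) / real (m n)"
  unfolding empirical_cdf_def initial_indices_def
    sum.reindex[OF index_seqs_inj[OF assms]] card_image[OF index_seqs_inj[OF assms]]
  by simp

text \<open>Here \<open>I n\<close> stands for the set of good indices at stage \<open>n\<close>. The averaged law of the selected
  observations is the mixture whose weight \<open>a n\<close> is the current fraction of bad indices; replacing
  \<open>a n\<close> by its limit \<open>\<alpha>\<close> costs at most \<open>\<bar>a n - \<alpha>\<bar>\<close> in Kolmogorov distance. The
  Glivenko--Cantelli theorem applies to the whole sequence \<open>X (k 1), X (k 2), \<dots>\<close>, and its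
  conclusion is read off at the sizes \<open>m n\<close>, which need not be monotone in \<open>n\<close>.\<close>

lemma (in prob_space) empirical_cdf_tendsto_mixture:
  fixes X :: "nat \<Rightarrow> 'a \<Rightarrow> real ^ 'p"
  assumes indep: "\<And>n. n \<ge> 1 \<Longrightarrow> indep_vars (\<lambda>_. borel) X {1..n}"
    and k: "k \<in> index_seqs"
    and F: "\<And>n i. n \<ge> 1 \<Longrightarrow> i \<in> I n \<Longrightarrow> mcdf (distr M borel (X i)) = F"
    and G: "\<And>n i. n \<ge> 1 \<Longrightarrow> i \<in> {1..n} - I n \<Longrightarrow> mcdf (distr M borel (X i)) = G"
    and unit: "\<And>x. F x \<in> {0..1}" "\<And>x. G x \<in> {0..1}"
    and sub: "\<And>n. n \<ge> 1 \<Longrightarrow> initial_indices k m n \<subseteq> {1..n}"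
    and m: "filterlim m at_top sequentially"
    and \<alpha>: "(\<lambda>n. (\<Sum>i=1..m n. of_bool (k i \<notin> I n)) / real (m n)) \<longlonglongrightarrow> \<alpha>"
  shows "AE w in M. (\<lambda>n. kolmogorov_dist (empirical_cdf X (initial_indices k m n) w)
    (\<lambda>x. (1 - \<alpha>) * F x + \<alpha> * G x)) \<longlonglongrightarrow> 0"
proof -
  define a where "a n = (\<Sum>i=1..m n. of_bool (k i \<notin> I n)) / real (m n)" for n
  have X: "X i \<in> measurable M borel" if "i \<ge> 1" for i
    using indep[of i] that unfolding indep_vars_def by auto
  \<comment> \<open>The observation \<open>X i\<close> is already classified at stage \<open>n = i\<close>.\<close>
  have law: "mcdf (distr M borel (X i)) \<in> {F, G}" if "i \<ge> 1" for i
    using F[OF that, of i] G[OF that, of i] that by (cases "i \<in> I i") auto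
  have indepk: "indep_vars (\<lambda>_. borel) (\<lambda>i. X (k i)) {1..n}" for n
  proof (cases "n = 0")
    case True
    then show ?thesis by (simp add: indep_vars_def indep_sets_def)
  next
    case False
    have "k ` {1..n} \<subseteq> {1..Max (k ` {1..n})}"
      using index_seqs_ge_1[OF k] by auto
    moreover have "1 \<le> Max (k ` {1..n})"
      using False index_seqs_ge_1[OF k, of n] by (auto simp: Max_ge_iff)
    ultimately have "indep_vars (\<lambda>_. borel) X (k ` {1..n})"
      by (rule indep_vars_subset[OF indep, rotated])
    then show ?thesis by (rule indep_vars_reindex[OF _ index_seqs_inj[OF k]])
  qed
  have "finite ((\<lambda>i. distr M borel (X (k i))) ` {1..})"
  proof (rule finite_imageD)
    have "mcdf ` (\<lambda>i. distr M borel (X (k i))) ` {1..} \<subseteq> {F, G}"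
      using law index_seqs_ge_1[OF k] by blast
    then show "finite (mcdf ` (\<lambda>i. distr M borel (X (k i))) ` {1..})"
      by (rule finite_subset) simp
    show "inj_on mcdf ((\<lambda>i. distr M borel (X (k i))) ` {1..})"
      using prob_space_distr[OF X[OF index_seqs_ge_1[OF k]]]
      by (intro inj_onI measure_eqI_mcdf) auto
  qed
  then have "AE w in M. uniform_limit UNIV
    (\<lambda>j x. (\<Sum>i=1..j. of_bool (X (k i) w \<le> x)) / real j
      - (\<Sum>i=1..j. mcdf (distr M borel (X (k i))) x) / real j) (\<lambda>_. 0) sequentially"
    by (intro glivenko_cantelli indepk)
  then show ?thesis
  proof (rule eventually_mono)
    fix w assume "uniform_limit UNIV
      (\<lambda>j x. (\<Sum>i=1..j. of_bool (X (k i) w \<le> x)) / real j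
        - (\<Sum>i=1..j. mcdf (distr M borel (X (k i))) x) / real j) (\<lambda>_. 0) sequentially"
    then have gc: "\<forall>\<^sub>F j in sequentially. \<forall>x. \<bar>(\<Sum>i=1..j. of_bool (X (k i) w \<le> x)) / real j
        - (\<Sum>i=1..j. mcdf (distr M borel (X (k i))) x) / real j\<bar> < e" if "e > 0" for e
      using that by (auto simp: uniform_limit_iff)
    show "(\<lambda>n. kolmogorov_dist (empirical_cdf X (initial_indices k m n) w)
      (\<lambda>x. (1 - \<alpha>) * F x + \<alpha> * G x)) \<longlonglongrightarrow> 0"
    proof (rule tendstoI)
      fix e :: real assume "e > 0"
      have "\<forall>\<^sub>F n in sequentially. \<bar>a n - \<alpha>\<bar> < e / 3"
        using tendstoD[OF \<alpha>, of "e / 3"] \<open>e > 0\<close> by (simp add: a_def dist_real_def)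
      moreover have "\<forall>\<^sub>F n in sequentially. m n \<ge> 1"
        using m by (simp add: filterlim_at_top)
      moreover have "\<forall>\<^sub>F n in sequentially. n \<ge> 1" by (rule eventually_ge_at_top)
      moreover have "\<forall>\<^sub>F n in sequentially. \<forall>x.
          \<bar>(\<Sum>i=1..m n. of_bool (X (k i) w \<le> x)) / real (m n)
            - (\<Sum>i=1..m n. mcdf (distr M borel (X (k i))) x) / real (m n)\<bar> < e / 3"
        by (rule eventually_compose_filterlim[OF gc m]) (use \<open>e > 0\<close> in simp)
      ultimately show "\<forall>\<^sub>F n in sequentially. dist (kolmogorov_dist
          (empirical_cdf X (initial_indices k m n) w) (\<lambda>x. (1 - \<alpha>) * F x + \<alpha> * G x)) 0 < e"
      proof eventually_elim
        case (elim n)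
        have mean: "(\<Sum>i=1..m n. mcdf (distr M borel (X (k i))) x) / real (m n)
            = (1 - a n) * F x + a n * G x" for x
        proof -
          have "(\<Sum>i=1..m n. mcdf (distr M borel (X (k i))) x)
              = (\<Sum>i=1..m n. F x + of_bool (k i \<notin> I n) * (G x - F x))"
          proof (rule sum.cong)
            fix i assume "i \<in> {1..m n}"
            then have "k i \<in> initial_indices k m n" by (simp add: initial_indices_def)
            then have "k i \<in> {1..n}" using sub[OF elim(3)] by blast
            then show "mcdf (distr M borel (X (k i))) x = F x + of_bool (k i \<notin> I n) * (G x - F x)"
              using F[of n "k i"] G[of n "k i"] elim by (cases "k i \<in> I n") auto
          qed simp
          also have "\<dots> = real (m n) * F x + (\<Sum>i=1..m n. of_bool (k i \<notin> I n)) * (G x - F x)"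
            unfolding sum.distrib sum_distrib_right[symmetric] by simp
          also have "(\<Sum>i=1..m n. of_bool (k i \<notin> I n)) = real (m n) * a n"
            using elim by (simp add: a_def)
          finally show ?thesis using elim by (simp add: field_simps)
        qed
        have "kolmogorov_dist (empirical_cdf X (initial_indices k m n) w)
            (\<lambda>x. (1 - \<alpha>) * F x + \<alpha> * G x) \<le> e / 3 + e / 3"
        proof (rule kolmogorov_dist_le)
          fix x
          have "\<bar>((1 - a n) * F x + a n * G x) - ((1 - \<alpha>) * F x + \<alpha> * G x)\<bar>
              = \<bar>a n - \<alpha>\<bar> * \<bar>G x - F x\<bar>"
            unfolding abs_mult[symmetric] by (simp add: algebra_simps)
          also have "\<dots> \<le> \<bar>a n - \<alpha>\<bar> * 1"
            using unit[of x] by (intro mult_left_mono) auto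
          also have "\<dots> \<le> e / 3" using elim(1) by simp
          finally have "\<bar>((1 - a n) * F x + a n * G x) - ((1 - \<alpha>) * F x + \<alpha> * G x)\<bar> \<le> e / 3" .
          moreover have "\<bar>empirical_cdf X (initial_indices k m n) w x
              - ((1 - a n) * F x + a n * G x)\<bar> < e / 3"
            using elim(4) unfolding mean empirical_cdf_initial_indices[OF k] by blast
          ultimately show "\<bar>empirical_cdf X (initial_indices k m n) w x
              - ((1 - \<alpha>) * F x + \<alpha> * G x)\<bar> \<le> e / 3 + e / 3" by linarith
        qed
        moreover have "0 \<le> kolmogorov_dist (empirical_cdf X (initial_indices k m n) w)
            (\<lambda>x. (1 - \<alpha>) * F x + \<alpha> * G x)"
        proof -
          have "0 \<le> a n" "a n \<le> 1" for n
          proof -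
            have "(\<Sum>i=1..m n. of_bool (k i \<notin> I n) :: real) \<le> (\<Sum>i=1..m n. 1)"
              by (intro sum_mono) auto
            then show "a n \<le> 1" unfolding a_def by (cases "m n = 0") auto
            show "0 \<le> a n" unfolding a_def by (intro divide_nonneg_nonneg sum_nonneg) auto
          qed
          then have "0 \<le> \<alpha>" "\<alpha> \<le> 1"
            using \<alpha> unfolding a_def[symmetric] by (auto intro: LIMSEQ_le_const LIMSEQ_le_const2)
          then show ?thesis
            by (intro kolmogorov_dist_nonneg convex_combination_unit_interval
                empirical_cdf_unit_interval unit)
        qed
        ultimately show ?case using \<open>e > 0\<close> by simp
      qed
    qed
  qed
qed

section \<open>Separation of good from bad decisions\<close>

text \<open>The bad indices selected at stage \<open>n\<close> are among the \<open>n - l n\<close> contaminated ones. Dividing by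
  \<open>n\<close> turns the fraction of bad indices into a product with \<open>m n / n\<close>, and both sides converge.\<close>

lemma bad_fraction_le:
  assumes "k0 \<in> index_seqs" "k \<in> index_seqs"
    and sub0: "\<And>n. n \<ge> 1 \<Longrightarrow> initial_indices k0 l n \<subseteq> {1..n}"
    and sub: "\<And>n. n \<ge> 1 \<Longrightarrow> initial_indices k m n \<subseteq> {1..n}"
    and l: "(\<lambda>n. real (l n) / real n) \<longlonglongrightarrow> 1 - \<epsilon>"
    and m: "(\<lambda>n. real (m n) / real n) \<longlonglongrightarrow> \<tau>"
    and \<alpha>: "(\<lambda>n. (\<Sum>i=1..m n. of_bool (k i \<notin> initial_indices k0 l n)) / real (m n)) \<longlonglongrightarrow> \<alpha>"
  shows "\<alpha> * \<tau> \<le> \<epsilon>"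
proof (rule LIMSEQ_le)
  show "(\<lambda>n. (\<Sum>i=1..m n. of_bool (k i \<notin> initial_indices k0 l n)) / real (m n)
      * (real (m n) / real n)) \<longlonglongrightarrow> \<alpha> * \<tau>"
    by (intro tendsto_mult \<alpha> m)
  have "(\<lambda>n. 1 - real (l n) / real n) \<longlonglongrightarrow> 1 - (1 - \<epsilon>)"
    by (intro tendsto_diff tendsto_const l)
  then show "(\<lambda>n. 1 - real (l n) / real n) \<longlonglongrightarrow> \<epsilon>" by simp
  have "(\<Sum>i=1..m n. of_bool (k i \<notin> initial_indices k0 l n)) / real (m n) * (real (m n) / real n)
      \<le> 1 - real (l n) / real n" if n: "n \<ge> 1" for n
  proof -
    let ?A = "initial_indices k0 l n"
    have "(\<Sum>i=1..m n. of_bool (k i \<notin> ?A)) = (\<Sum>i\<in>initial_indices k m n. of_bool (i \<notin> ?A) :: real)"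
      unfolding initial_indices_def[of k] sum.reindex[OF index_seqs_inj[OF assms(2)]] by simp
    also have "\<dots> \<le> (\<Sum>i\<in>{1..n}. of_bool (i \<notin> ?A))"
      by (rule sum_mono2) (use sub[OF n] in auto)
    also have "\<dots> = real (card ({1..n} - ?A))"
      by (simp add: sum.If_cases of_bool_def Diff_eq Compl_eq)
    also have "\<dots> = real n - real (card ?A)"
      using card_Diff_subset[of ?A "{1..n}"] card_mono[OF _ sub0[OF n]] sub0[OF n]
      by (simp add: finite_subset of_nat_diff)
    also have "card ?A = l n"
      unfolding initial_indices_def card_image[OF index_seqs_inj[OF assms(1)]] by simp
    finally have "(\<Sum>i=1..m n. of_bool (k i \<notin> ?A)) / real n \<le> 1 - real (l n) / real n"
      using n by (simp add: field_simps)
    moreover have "0 \<le> 1 - real (l n) / real n" 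
      using card_mono[OF _ sub0[OF n]] n
      unfolding initial_indices_def card_image[OF index_seqs_inj[OF assms(1)]] by simp
    ultimately show ?thesis by (cases "m n = 0") auto
  qed
  then show "\<exists>N. \<forall>n\<ge>N. (\<Sum>i=1..m n. of_bool (k i \<notin> initial_indices k0 l n)) / real (m n)
      * (real (m n) / real n) \<le> 1 - real (l n) / real n"
    by blast
qed

theorem theorem5p2:
  fixes M :: "'w measure"
    and X :: "nat \<Rightarrow> 'w \<Rightarrow> real ^ 'p"
    and \<Theta> :: "(real ^ 'q) set" and \<theta>0 :: "real ^ 'q"
    and F :: "real ^ 'q \<Rightarrow> real ^ 'p \<Rightarrow> real" and G :: "real ^ 'p \<Rightarrow> real"
    and \<epsilon> \<tau> :: real
    and l m k0 :: "nat \<Rightarrow> nat"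
    and A0 :: "nat \<Rightarrow> nat set"
  defines "A0 \<equiv> initial_indices k0 l"
  assumes "prob_space M"
    and "\<And>\<theta>. \<theta> \<in> \<Theta> \<Longrightarrow> F \<theta> \<in> distribution_functions"
    and "G \<in> distribution_functions"
    and "\<theta>0 \<in> \<Theta>"
    and "0 \<le> \<epsilon>" and "\<epsilon> \<le> 1/2"
    and "mono_on {1..} l" and "(\<lambda>n. real (l n) / real n) \<longlonglongrightarrow> 1 - \<epsilon>"
    and "k0 \<in> index_seqs"
    and "\<And>n. n \<ge> 1 \<Longrightarrow> A0 n \<subseteq> {1..n}"
    and "\<And>n. n \<ge> 1 \<Longrightarrow> prob_space.indep_vars M (\<lambda>_. borel) X {1..n}"
    and "\<And>n i. n \<ge> 1 \<Longrightarrow> i \<in> A0 n \<Longrightarrow> mcdf (distr M borel (X i)) = F \<theta>0"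
    and "\<And>n i. n \<ge> 1 \<Longrightarrow> i \<in> {1..n} - A0 n \<Longrightarrow> mcdf (distr M borel (X i)) = G"
    and "\<And>n. n \<ge> 1 \<Longrightarrow> m n < n"
    and "\<forall>\<^sub>F n in sequentially. m n \<le> card (A0 n)"
    and "(\<lambda>n. real (m n) / real n) \<longlonglongrightarrow> \<tau>" and "1/2 \<le> \<tau>" and "\<tau> \<le> 1 - \<epsilon>"
    and "\<And>\<alpha>. 0 < \<alpha> \<Longrightarrow> \<alpha> \<le> \<epsilon> / (1 - \<tau>) \<Longrightarrow>
      (INF \<theta>\<in>\<Theta>. kolmogorov_dist (\<lambda>x. (1 - \<alpha>) * F \<theta>0 x + \<alpha> * G x) (F \<theta>)) > 0"
  shows "weakly_separates M
    (\<lambda>n A w. INF \<theta>\<in>\<Theta>. kolmogorov_dist (empirical_cdf X A w) (F \<theta>))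
    (good_decisions m A0) (bad_decisions m A0)"
proof -
  note F_cdf = assms(3) and G_cdf = assms(4) and l_lim = assms(9) and k0_index = assms(10)
    and A0_sub = assms(11) and indep = assms(12) and good_law = assms(13) and bad_law = assms(14)
    and m_lim = assms(17) and mixture_gap = assms(20)
  interpret prob_space M by fact
  have F_unit: "F \<theta> x \<in> {0..1}" if "\<theta> \<in> \<Theta>" for \<theta> x
    using F_cdf[OF that] by (rule distribution_functions_unit_interval)
  have G_unit: "G x \<in> {0..1}" for x
    using G_cdf by (rule distribution_functions_unit_interval)
  \<comment> \<open>The sample sizes grow, since \<open>m n / n\<close> has the positive limit \<open>\<tau>\<close>.\<close>
  have "filterlim (\<lambda>n. real (m n) / real n * real n) at_top sequentially"
    using m_lim \<open>1/2 \<le> \<tau>\<close>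
    by (intro filterlim_tendsto_pos_mult_at_top[OF m_lim] filterlim_real_sequentially) auto
  then have m_top: "filterlim m at_top sequentially"
    unfolding filterlim_sequentially_iff_filterlim_real
    by (rule filterlim_mono_eventually)
       (auto intro!: eventually_sequentiallyI[of 1] simp del: of_nat_eq_0_iff)
  have consistent: "AE w in M. (\<lambda>n. kolmogorov_dist (empirical_cdf X (initial_indices k m n) w)
      (\<lambda>x. (1 - \<beta>) * F \<theta>0 x + \<beta> * G x)) \<longlonglongrightarrow> 0"
    if "k \<in> index_seqs" "\<And>n. n \<ge> 1 \<Longrightarrow> initial_indices k m n \<subseteq> {1..n}"
      "(\<lambda>n. (\<Sum>i=1..m n. of_bool (k i \<notin> A0 n)) / real (m n)) \<longlonglongrightarrow> \<beta>" for k \<beta>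
    by (rule empirical_cdf_tendsto_mixture[where I = A0])
       (fact indep that(1) good_law bad_law F_unit[OF \<open>\<theta>0 \<in> \<Theta>\<close>] G_unit that(2) m_top that(3))+
  define \<psi> where "\<psi> A w = (INF \<theta>\<in>\<Theta>. kolmogorov_dist (empirical_cdf X A w) (F \<theta>))" for A w
  have sep: "AE w in M. limsup (\<lambda>n. ereal (\<psi> (A n) w - \<psi> (B n) w)) < 0"
    if A: "A \<in> good_decisions m A0" and B: "B \<in> bad_decisions m A0" for A B
  proof -
    obtain k where k: "k \<in> index_seqs" "\<And>n. n \<ge> 1 \<Longrightarrow> initial_indices k m n \<subseteq> A0 n"
      "\<And>n. n \<ge> 1 \<Longrightarrow> A n = initial_indices k m n"
      using A by (auto simp: good_decisions_def decisions_along_def good_seqs_def)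
    obtain k' \<alpha> where k': "k' \<in> index_seqs" "\<And>n. n \<ge> 1 \<Longrightarrow> B n = initial_indices k' m n"
      and \<alpha>: "\<alpha> > 0" "(\<lambda>n. (\<Sum>i=1..m n. of_bool (k' i \<notin> A0 n)) / real (m n)) \<longlonglongrightarrow> \<alpha>"
      using B by (auto simp: bad_decisions_def decisions_along_def bad_seqs_def)
    have sub: "initial_indices k m n \<subseteq> {1..n}" "initial_indices k' m n \<subseteq> {1..n}" if "n \<ge> 1" for n
      using A B that k(3) k'(2)
      by (auto simp: good_decisions_def bad_decisions_def decisions_along_def decision_space_def Pi_iff)
    have "\<alpha> * \<tau> \<le> \<epsilon>"
      using k0_index k'(1) A0_sub sub(2) l_lim m_lim \<alpha>(2)
      unfolding A0_def by (rule bad_fraction_le)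
    \<comment> \<open>If \<open>\<tau> = 1\<close>, then \<open>\<epsilon> = 0\<close>, so the fraction of bad indices vanishes in the limit, contrary
      to \<open>\<alpha> > 0\<close>. The bound \<open>\<epsilon> / (1 - \<tau>)\<close> is thus not a division by zero.\<close>
    have "\<tau> < 1"
    proof (rule ccontr)
      assume "\<not> \<tau> < 1"
      then have "\<epsilon> \<le> 0" "\<alpha> * \<tau> > 0" using \<open>\<tau> \<le> 1 - \<epsilon>\<close> \<open>\<alpha> > 0\<close> by auto
      then show False using \<open>\<alpha> * \<tau> \<le> \<epsilon>\<close> by simp
    qed
    have "\<alpha> * (1 - \<tau>) \<le> \<alpha> * \<tau>" using \<open>\<alpha> > 0\<close> \<open>1/2 \<le> \<tau>\<close> by (intro mult_left_mono) auto
    then have "\<alpha> \<le> \<epsilon> / (1 - \<tau>)" using \<open>\<alpha> * \<tau> \<le> \<epsilon>\<close> \<open>\<tau> < 1\<close> by (simp add: field_simps)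
    define K where "K x = (1 - \<alpha>) * F \<theta>0 x + \<alpha> * G x" for x
    define c where "c = (INF \<theta>\<in>\<Theta>. kolmogorov_dist K (F \<theta>))"
    have "c > 0"
      unfolding c_def K_def using \<open>\<alpha> > 0\<close> \<open>\<alpha> \<le> \<epsilon> / (1 - \<tau>)\<close> by (rule mixture_gap)
    have "\<alpha> \<le> 1"
    proof -
      have "\<alpha> * (1/2) \<le> \<alpha> * \<tau>" using \<open>\<alpha> > 0\<close> \<open>1/2 \<le> \<tau>\<close> by (intro mult_left_mono) auto
      then show ?thesis using \<open>\<alpha> * \<tau> \<le> \<epsilon>\<close> \<open>\<epsilon> \<le> 1/2\<close> by simp
    qed
    have K_unit: "K x \<in> {0..1}" for x
      unfolding K_def using \<open>\<alpha> > 0\<close> \<open>\<alpha> \<le> 1\<close> F_unit[OF \<open>\<theta>0 \<in> \<Theta>\<close>] G_unit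
      by (intro convex_combination_unit_interval) auto
    have "(\<lambda>n. (\<Sum>i=1..m n. of_bool (k i \<notin> A0 n)) / real (m n)) \<longlonglongrightarrow> 0"
    proof (rule tendsto_eventually, rule eventually_sequentiallyI[of 1])
      fix n :: nat assume "n \<ge> 1"
      then have "k i \<in> A0 n" if "i \<in> {1..m n}" for i
        using k(2)[of n] that by (auto simp: initial_indices_def)
      then have "(\<Sum>i=1..m n. of_bool (k i \<notin> A0 n) :: real) = 0" by (intro sum.neutral) auto
      then show "(\<Sum>i=1..m n. of_bool (k i \<notin> A0 n)) / real (m n) = 0" by simp
    qed
    from consistent[OF k(1) sub(1) this]
    have good: "AE w in M. (\<lambda>n. kolmogorov_dist (empirical_cdf X (initial_indices k m n) w) (F \<theta>0))
        \<longlonglongrightarrow> 0" by simp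
    have bad: "AE w in M. (\<lambda>n. kolmogorov_dist (empirical_cdf X (initial_indices k' m n) w) K)
        \<longlonglongrightarrow> 0"
      using consistent[OF k'(1) sub(2) \<alpha>(2)] unfolding K_def by simp
    from good bad show ?thesis
    proof eventually_elim
      case (elim w)
      have "\<forall>\<^sub>F n in sequentially. kolmogorov_dist (empirical_cdf X (initial_indices k m n) w) (F \<theta>0) < c / 3"
        using order_tendstoD(2)[OF elim(1), of "c / 3"] \<open>c > 0\<close> by simp
      moreover have "\<forall>\<^sub>F n in sequentially. kolmogorov_dist (empirical_cdf X (initial_indices k' m n) w) K < c / 3"
        using order_tendstoD(2)[OF elim(2), of "c / 3"] \<open>c > 0\<close> by simp
      moreover have "\<forall>\<^sub>F n in sequentially. n \<ge> 1" by (rule eventually_ge_at_top)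
      ultimately have "\<forall>\<^sub>F n in sequentially. ereal (\<psi> (A n) w - \<psi> (B n) w) \<le> ereal (- (c / 3))"
      proof eventually_elim
        case (elim n)
        have "\<psi> (A n) w \<le> kolmogorov_dist (empirical_cdf X (A n) w) (F \<theta>0)"
          unfolding \<psi>_def
          by (intro INF_kolmogorov_dist_le_dist \<open>\<theta>0 \<in> \<Theta>\<close> F_unit empirical_cdf_unit_interval)
        moreover have "c \<le> kolmogorov_dist (empirical_cdf X (B n) w) K + \<psi> (B n) w"
          unfolding \<psi>_def c_def using \<open>\<theta>0 \<in> \<Theta>\<close>
          by (intro INF_kolmogorov_dist_triangle F_unit K_unit empirical_cdf_unit_interval) auto
        ultimately show ?case using elim k(3) k'(2) by simp
      qed
      then have "limsup (\<lambda>n. ereal (\<psi> (A n) w - \<psi> (B n) w)) \<le> ereal (- (c / 3))"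
        by (rule Limsup_bounded)
      also have "\<dots> < 0" using \<open>c > 0\<close> by simp
      finally show ?case .
    qed
  qed
  then show ?thesis
    unfolding weakly_separates_def \<psi>_def by blast
qed

end
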